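(* Let $\Gamma$ be the embedded graph with vertices $v,u_1,u_2,u_3$ and the following nine edges: for each $i\in\{1,2,3\}$ an edge $b_i$ joining $u_i$ and $v$, and two loops $\ell_i, m_i$ at $u_i$; the rotation system is given by the cyclic orders $\pi_v=(b_1\,b_2\,b_3)$ and $\pi_{u_i}=(b_i\,\ell_i\,m_i\,\ell_i\,m_i)$ for $i=1,2,3$. Then $\Gamma$ admits a nowhere-identity $D_6$-flow, but $\Gamma$ does not admit a nowhere-identity dihedral $3$-flow. In particular, the statement "an embedded graph admits a nowhere-identity $D_{2n}$-flow if and only if it admits a nowhere-identity dihedral $n$-flow" is false for $n=3$.
   Context: Graphs are finite and connected and may have loops and parallel edges. An embedded graph is a graph $\Gamma=(V,E)$ with a rotation system $\pi=\{\pi_v\mid v\in V\}$, where $\pi_v$ is a cyclic order of the edges incident with $v$ (a loop at $v$ appears twice, once for each of its ends); this is equivalent to a cellular embedding of $\Gamma$ in a closed connected orientable surface. For a group $G$ and an orientation of the edges, a $G$-flow is a map $f:E\to G$ such that at each vertex $v$ the product of the values of the incident edges, taken in the order $\pi_v$, is the identity, where the inverse $f(e)^{-1}$ is used for an edge leaving $v$ (so a loop contributes $f(e)$ at one end and $f(e)^{-1}$ at the other). It is nowhere-identity if $f(e)\neq 1$ for all $e$. Existence of a nowhere-identity $G$-flow does not depend on the chosen orientation. $D_{2n}=\{\begin{pmatrix}\pm1&a\\0&1\end{pmatrix}\mid a\in\mathbb{Z}/n\mathbb{Z}\}$ is the dihedral group of order $2n$. Let $\mathbb{D}=\{\begin{pmatrix}\pm1&a\\0&1\end{pmatrix}\mid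 a\in\mathbb{Z}\}$ and $\mathbb{D}^{<n}=\{\begin{pmatrix}\pm1&a\\0&1\end{pmatrix}\in\mathbb{D}\mid |a|<n\}$. A nowhere-identity dihedral $n$-flow is a nowhere-identity $\mathbb{D}$-flow all of whose values lie in $\mathbb{D}^{<n}$. *)

theory Defs
  imports "Graph_Theory.Graph_Theory" "HOL-Algebra.IntRing" "HOL-Number_Theory.Residues"
begin

section \<open>Embedded graphs\<close>

text \<open>
  A finite multigraph with loops is given by a \<open>pre_digraph\<close> whose arcs are the edges. Its
  directions have no meaning beyond naming the two ends of an edge \<open>e\<close>: the end \<open>(e, False)\<close>
  lies at \<open>tail e\<close> and the end \<open>(e, True)\<close> lies at \<open>head e\<close>, so that a loop has two distinct
  ends at its vertex. The cyclic order at \<open>v\<close> is given by listing it from an arbitrary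
  starting point; the flow condition below does not depend on that starting point.
\<close>

record ('v, 'e) embedded_graph =
  graph :: "('v, 'e) pre_digraph"
  rotation :: "'v \<Rightarrow> ('e \<times> bool) list"

fun end_vertex :: "('v, 'e) pre_digraph \<Rightarrow> 'e \<times> bool \<Rightarrow> 'v" where
  "end_vertex G (e, False) = tail G e"
| "end_vertex G (e, True) = head G e"

definition is_embedded_graph :: "('v, 'e) embedded_graph \<Rightarrow> bool" where
  "is_embedded_graph \<Gamma> \<longleftrightarrow>
     fin_digraph (graph \<Gamma>) \<and> Digraph_Component.connected (graph \<Gamma>) \<and>
     (\<forall>v \<in> verts (graph \<Gamma>).
        distinct (rotation \<Gamma> v) \<and>
        set (rotation \<Gamma> v) = {d \<in> arcs (graph \<Gamma>) \<times> UNIV. end_vertex (graph \<Gamma>) d = v})"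

section \<open>Flows\<close>

text \<open>
  An orientation \<open>\<sigma>\<close> directs every edge \<open>e\<close> towards its end \<open>(e, \<sigma> e)\<close>.
\<close>

definition end_value ::
    "('g, 'm) monoid_scheme \<Rightarrow> ('e \<Rightarrow> bool) \<Rightarrow> ('e \<Rightarrow> 'g) \<Rightarrow> 'e \<times> bool \<Rightarrow> 'g" where
  "end_value G \<sigma> f d = (if snd d = \<sigma> (fst d) then f (fst d) else inv\<^bsub>G\<^esub> (f (fst d)))"

definition is_flow ::
    "('g, 'm) monoid_scheme \<Rightarrow> ('v, 'e) embedded_graph \<Rightarrow> ('e \<Rightarrow> bool) \<Rightarrow> ('e \<Rightarrow> 'g) \<Rightarrow> bool" where
  "is_flow G \<Gamma> \<sigma> f \<longleftrightarrow>
     f \<in> arcs (graph \<Gamma>) \<rightarrow> carrier G \<and>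
     (\<forall>v \<in> verts (graph \<Gamma>).
        foldr (\<lambda>x y. x \<otimes>\<^bsub>G\<^esub> y) (map (end_value G \<sigma> f) (rotation \<Gamma> v)) \<one>\<^bsub>G\<^esub> = \<one>\<^bsub>G\<^esub>)"

definition nowhere_identity ::
    "('g, 'm) monoid_scheme \<Rightarrow> ('v, 'e) embedded_graph \<Rightarrow> ('e \<Rightarrow> 'g) \<Rightarrow> bool" where
  "nowhere_identity G \<Gamma> f \<longleftrightarrow> (\<forall>e \<in> arcs (graph \<Gamma>). f e \<noteq> \<one>\<^bsub>G\<^esub>)"

definition admits_nowhere_identity_flow ::
    "('g, 'm) monoid_scheme \<Rightarrow> ('v, 'e) embedded_graph \<Rightarrow> bool" where
  "admits_nowhere_identity_flow G \<Gamma> \<longleftrightarrow>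
     (\<exists>\<sigma> f. is_flow G \<Gamma> \<sigma> f \<and> nowhere_identity G \<Gamma> f)"

text \<open>
  The choice of \<open>\<sigma>\<close> is irrelevant: reversing an edge and inverting its value preserves flows.
\<close>

lemma is_flow_reorient:
  assumes "group G" "is_embedded_graph \<Gamma>" "is_flow G \<Gamma> \<sigma> f"
  shows "is_flow G \<Gamma> \<tau> (\<lambda>e. if \<sigma> e = \<tau> e then f e else inv\<^bsub>G\<^esub> (f e))"
proof -
  interpret group G by fact
  have f: "f \<in> arcs (graph \<Gamma>) \<rightarrow> carrier G" using assms by (simp add: is_flow_def)
  have "map (end_value G \<tau> (\<lambda>e. if \<sigma> e = \<tau> e then f e else inv\<^bsub>G\<^esub> (f e))) (rotation \<Gamma> v)
     = map (end_value G \<sigma> f) (rotation \<Gamma> v)" if "v \<in> verts (graph \<Gamma>)" for v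
  proof (rule map_cong[OF refl])
    fix d assume "d \<in> set (rotation \<Gamma> v)"
    then have "f (fst d) \<in> carrier G" using assms(2) that f by (auto simp: is_embedded_graph_def)
    then show "end_value G \<tau> (\<lambda>e. if \<sigma> e = \<tau> e then f e else inv\<^bsub>G\<^esub> (f e)) d = end_value G \<sigma> f d"
      by (auto simp: end_value_def)
  qed
  then show ?thesis using assms(3) f by (auto simp: is_flow_def Pi_iff simp del: map_eq_conv)
qed

section \<open>Dihedral groups\<close>

text \<open>\<open>Mat2 a b c d\<close> is the matrix with rows \<open>(a, b)\<close> and \<open>(c, d)\<close>.\<close>

datatype 'a mat2 = Mat2 'a 'a 'a 'a

fun mat2_mult :: "('a, 'm) ring_scheme \<Rightarrow> 'a mat2 \<Rightarrow> 'a mat2 \<Rightarrow> 'a mat2" where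
  "mat2_mult R (Mat2 a b c d) (Mat2 a' b' c' d') =
     Mat2 (a \<otimes>\<^bsub>R\<^esub> a' \<oplus>\<^bsub>R\<^esub> b \<otimes>\<^bsub>R\<^esub> c') (a \<otimes>\<^bsub>R\<^esub> b' \<oplus>\<^bsub>R\<^esub> b \<otimes>\<^bsub>R\<^esub> d')
          (c \<otimes>\<^bsub>R\<^esub> a' \<oplus>\<^bsub>R\<^esub> d \<otimes>\<^bsub>R\<^esub> c') (c \<otimes>\<^bsub>R\<^esub> b' \<oplus>\<^bsub>R\<^esub> d \<otimes>\<^bsub>R\<^esub> d')"

definition dihedral_matrices :: "('a, 'm) ring_scheme \<Rightarrow> 'a mat2 monoid" where
  "dihedral_matrices R =
     \<lparr> carrier = {Mat2 s a \<zero>\<^bsub>R\<^esub> \<one>\<^bsub>R\<^esub> | s a. s \<in> {\<one>\<^bsub>R\<^esub>, \<ominus>\<^bsub>R\<^esub> \<one>\<^bsub>R\<^esub>} \<and> a \<in> carrier R},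
       monoid.mult = mat2_mult R,
       one = Mat2 \<one>\<^bsub>R\<^esub> \<zero>\<^bsub>R\<^esub> \<zero>\<^bsub>R\<^esub> \<one>\<^bsub>R\<^esub> \<rparr>"

text \<open>
  \<open>dihedral_group n\<close> is the group $D_{2n}$. It has order \<open>2 * n\<close> for \<open>n \<ge> 3\<close>; for \<open>n = 2\<close>
  the matrix description degenerates because $1 = -1$.
\<close>

definition dihedral_group :: "nat \<Rightarrow> int mat2 monoid" where
  "dihedral_group n = dihedral_matrices (residue_ring (int n))"

definition infinite_dihedral_group :: "int mat2 monoid" where
  "infinite_dihedral_group = dihedral_matrices \<Z>"

definition dihedral_below :: "nat \<Rightarrow> int mat2 set" where
  "dihedral_below n =
     {Mat2 s a c d | s a c d. Mat2 s a c d \<in> carrier infinite_dihedral_group \<and> \<bar>a\<bar> < int n}"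

definition admits_nowhere_identity_dihedral_flow ::
    "nat \<Rightarrow> ('v, 'e) embedded_graph \<Rightarrow> bool" where
  "admits_nowhere_identity_dihedral_flow n \<Gamma> \<longleftrightarrow>
     (\<exists>\<sigma> f. is_flow infinite_dihedral_group \<Gamma> \<sigma> f \<and>
        nowhere_identity infinite_dihedral_group \<Gamma> f \<and>
        f ` arcs (graph \<Gamma>) \<subseteq> dihedral_below n)"

section \<open>The example\<close>

text \<open>
  The vertex and edge types are countably infinite, so that every finite graph has an
  isomorphic copy over them. Which of the two occurrences of a loop in the rotation is called
  its \<open>False\<close> end is immaterial, since flows may use any orientation.
\<close>

datatype vertex = V | U nat
datatype edge = B nat | L nat | M nat

definition example_graph :: "(vertex, edge) embedded_graph" where
  "example_graph =
     \<lparr> graph =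
         \<lparr> verts = {V} \<union> U ` {1, 2, 3},
           arcs = B ` {1, 2, 3} \<union> L ` {1, 2, 3} \<union> M ` {1, 2, 3},
           tail = (\<lambda>e. case e of B i \<Rightarrow> U i | L i \<Rightarrow> U i | M i \<Rightarrow> U i),
           head = (\<lambda>e. case e of B i \<Rightarrow> V | L i \<Rightarrow> U i | M i \<Rightarrow> U i) \<rparr>,
       rotation = (\<lambda>v. case v of
           V \<Rightarrow> [(B 1, True), (B 2, True), (B 3, True)]
         | U i \<Rightarrow> [(B i, False), (L i, False), (M i, False), (L i, True), (M i, True)]) \<rparr>"

end

theory Submission
  imports Defs
begin

text \<open>
  The commutator of two elements of the infinite dihedral group is a translation by an even
  integer. The flow condition at \<open>u\<^sub>i\<close> makes the value of \<open>b\<^sub>i\<close> such a commutator, so in a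
  nowhere-identity dihedral 3-flow each \<open>b\<^sub>i\<close> is a translation by 2 or -2; three of those
  never sum to 0 at \<open>v\<close>. Modulo 3, however, the commutator of a translation with a reflection
  can be the translation by 1, and 1 + 1 + 1 = 0.
\<close>

text \<open>Working over an arbitrary commutative ring serves both the integers and the residues
  modulo 3.\<close>

lemma (in cring) dihedral_matrices_group: "group (dihedral_matrices R)"
proof (rule groupI)
  fix x assume "x \<in> carrier (dihedral_matrices R)"
  then obtain s a where x: "x = Mat2 s a \<zero> \<one>" and s: "s = \<one> \<or> s = \<ominus> \<one>" and a: "a \<in> carrier R"
    by (auto simp: dihedral_matrices_def)
  \<comment> \<open>Since \<open>s\<close> squares to one, a left inverse keeps the sign
    \<open>s\<close>; its translation entry must then cancel \<open>s \<otimes> a\<close>.\<close>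
  have "Mat2 s (\<ominus> (s \<otimes> a)) \<zero> \<one> \<in> carrier (dihedral_matrices R)"
    using s a by (auto simp: dihedral_matrices_def)
  moreover have "Mat2 s (\<ominus> (s \<otimes> a)) \<zero> \<one> \<otimes>\<^bsub>dihedral_matrices R\<^esub> x = \<one>\<^bsub>dihedral_matrices R\<^esub>"
    using s a by (auto simp: dihedral_matrices_def x l_minus r_neg l_neg)
  ultimately show "\<exists>y \<in> carrier (dihedral_matrices R). y \<otimes>\<^bsub>dihedral_matrices R\<^esub> x = \<one>\<^bsub>dihedral_matrices R\<^esub>"
    by blast
qed (auto simp: dihedral_matrices_def l_minus r_minus a_assoc minus_add)

text \<open>Holds for every orientation: exactly one end of an edge carries the value itself, the
  other its inverse. This lets the word at \<open>U i\<close> be read as a commutator without fixing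
  \<open>\<sigma>\<close>.\<close>

lemma end_value_opposite:
  assumes "group G" "f e \<in> carrier G"
  shows "end_value G \<sigma> f (e, True) = inv\<^bsub>G\<^esub> (end_value G \<sigma> f (e, False))"
  using assms by (auto simp: end_value_def group.inv_inv)

lemma end_value_closed:
  assumes "group G" "f (fst d) \<in> carrier G"
  shows "end_value G \<sigma> f d \<in> carrier G"
  using assms by (auto simp: end_value_def group.inv_closed)

lemma carrier_infinite_dihedral_group:
  "carrier infinite_dihedral_group = {Mat2 s a 0 1 | s a. s = 1 \<or> s = - 1}"
  by (auto simp: infinite_dihedral_group_def dihedral_matrices_def int_a_inv_eq)

lemma one_infinite_dihedral_group [simp]: "\<one>\<^bsub>infinite_dihedral_group\<^esub> = Mat2 1 0 0 1"
  by (simp add: infinite_dihedral_group_def dihedral_matrices_def)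

lemma mult_infinite_dihedral_group [simp]:
  "Mat2 s a 0 1 \<otimes>\<^bsub>infinite_dihedral_group\<^esub> Mat2 t b 0 1 = Mat2 (s * t) (s * b + a) 0 1"
  by (simp add: infinite_dihedral_group_def dihedral_matrices_def)

lemma group_infinite_dihedral_group: "group infinite_dihedral_group"
  unfolding infinite_dihedral_group_def by (rule cring.dihedral_matrices_group[OF int_is_cring])

lemma inv_infinite_dihedral_group [simp]:
  "s = 1 \<or> s = - 1 \<Longrightarrow> inv\<^bsub>infinite_dihedral_group\<^esub> (Mat2 s a 0 1) = Mat2 s (- (s * a)) 0 1"
  by (rule group.inv_equality[OF group_infinite_dihedral_group])
     (auto simp: carrier_infinite_dihedral_group)

text \<open>The sign is a homomorphism to an abelian group, and so is the translation entry modulo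
  2, because signs vanish modulo 2. Both are therefore trivial on commutators, and \<open>z\<close>
  is the inverse of one.\<close>

lemma infinite_dihedral_commutator_even:
  assumes "x \<in> carrier infinite_dihedral_group" "y \<in> carrier infinite_dihedral_group"
    and "z \<in> carrier infinite_dihedral_group"
    and "foldr (\<lambda>x y. x \<otimes>\<^bsub>infinite_dihedral_group\<^esub> y)
      [z, x, y, inv\<^bsub>infinite_dihedral_group\<^esub> x, inv\<^bsub>infinite_dihedral_group\<^esub> y]
      \<one>\<^bsub>infinite_dihedral_group\<^esub> = \<one>\<^bsub>infinite_dihedral_group\<^esub>"
  shows "\<exists>k. z = Mat2 1 (2 * k) 0 1"
proof -
  obtain s a t b r c where xyz: "x = Mat2 s a 0 1" "y = Mat2 t b 0 1" "z = Mat2 r c 0 1"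
    and signs: "s = 1 \<or> s = - 1" "t = 1 \<or> t = - 1" "r = 1 \<or> r = - 1"
    using assms(1-3) unfolding carrier_infinite_dihedral_group by blast
  have "r = 1" "even c"
    \<comment> \<open>Once the signs are split into cases, the word gives linear equations in the
      translation entries.\<close>
    using assms(4) signs unfolding xyz by (auto simp: algebra_simps) presburger+
  then show ?thesis unfolding xyz by (auto elim!: evenE)
qed

lemma example_graph_embedded: "is_embedded_graph example_graph"
proof -
  let ?G = "graph example_graph"
  have "fin_digraph ?G"
    by unfold_locales (auto simp: example_graph_def)
  moreover have "Digraph_Component.connected ?G"
  proof -
    interpret S: pair_wf_digraph "mk_symmetric ?G"
      using \<open>fin_digraph ?G\<close> by (intro wf_digraph.wellformed_mk_symmetric fin_digraph.axioms)
    \<comment> \<open>Loops aside, the graph is a star with centre \<open>V\<close>, so reachability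
      to and from \<open>V\<close> in the symmetric closure suffices.\<close>
    have star: "U i \<rightarrow>\<^sup>*\<^bsub>mk_symmetric ?G\<^esub> V \<and> V \<rightarrow>\<^sup>*\<^bsub>mk_symmetric ?G\<^esub> U i" if "i \<in> {1, 2, 3}" for i
    proof -
      have "(U i, V) \<in> parcs (mk_symmetric ?G)" "(V, U i) \<in> parcs (mk_symmetric ?G)"
        using that by (auto simp: parcs_mk_symmetric example_graph_def)
      then show ?thesis by (simp add: S.reachable_adjI)
    qed
    have to_centre: "u \<rightarrow>\<^sup>*\<^bsub>mk_symmetric ?G\<^esub> V \<and> V \<rightarrow>\<^sup>*\<^bsub>mk_symmetric ?G\<^esub> u" if "u \<in> verts ?G" for u
    proof (cases u)
      case V
      then show ?thesis using that by (simp add: S.reachable_refl)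
    next
      case (U i)
      then show ?thesis using that star[of i] by (auto simp: example_graph_def)
    qed
    moreover have "verts ?G \<noteq> {}" by (simp add: example_graph_def)
    ultimately show ?thesis
      unfolding Digraph_Component.connected_def strongly_connected_def
      by (auto intro: S.reachable_trans)
  qed
  moreover have "{d \<in> arcs ?G \<times> UNIV. end_vertex ?G d = v} = set (rotation example_graph v)"
    if "v \<in> verts ?G" for v
    using that by (auto simp: example_graph_def elim!: end_vertex.elims)
  moreover have "distinct (rotation example_graph v)" for v
    by (auto simp: example_graph_def split: vertex.split)
  ultimately show ?thesis by (simp add: is_embedded_graph_def)
qed

lemma example_graph_admits_dihedral_group_3:
  "admits_nowhere_identity_flow (dihedral_group 3) example_graph"
proof -
  interpret residues 3 "residue_ring 3"
    by unfold_locales simp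
  \<comment> \<open>Here 2 stands for -1, so \<open>L i\<close> is a reflection and
    \<open>M i\<close> a translation. Conjugation by the reflection inverts the translation, so with
    all edges directed to their \<open>True\<close> ends the loops at \<open>U i\<close> contribute
    the translation by 2 + 2 = 1, which cancels the inverse of \<open>B i\<close>.\<close>
  define f where "f = (\<lambda>e. case e of
    B i \<Rightarrow> Mat2 1 1 0 1 | L i \<Rightarrow> Mat2 2 0 0 1 | M i \<Rightarrow> Mat2 1 2 0 (1::int))"
  have carrier: "carrier (dihedral_group 3) = {Mat2 s a 0 1 | s a. s \<in> {1, 2} \<and> a \<in> {0, 1, 2}}"
  proof -
    have "\<ominus>\<^bsub>residue_ring 3\<^esub> 1 = 2" by (simp add: res_neg_eq)
    moreover have "carrier (residue_ring 3) = {0, 1, 2}" by (auto simp: residue_ring_def)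
    moreover have "\<one>\<^bsub>residue_ring 3\<^esub> = 1" "\<zero>\<^bsub>residue_ring 3\<^esub> = 0" by (simp_all add: residue_ring_def)
    ultimately show ?thesis by (simp add: dihedral_group_def dihedral_matrices_def)
  qed
  have one: "\<one>\<^bsub>dihedral_group 3\<^esub> = Mat2 1 0 0 1"
    by (simp add: dihedral_group_def dihedral_matrices_def residue_ring_def)
  have mult: "Mat2 s a 0 1 \<otimes>\<^bsub>dihedral_group 3\<^esub> Mat2 t b 0 1 = Mat2 (s * t mod 3) ((s * b + a) mod 3) 0 1"
    for s a t b
    by (simp add: dihedral_group_def dihedral_matrices_def residue_ring_def mod_simps)
  have "group (dihedral_group 3)"
    unfolding dihedral_group_def by (simp add: dihedral_matrices_group)
  then have inv: "inv\<^bsub>dihedral_group 3\<^esub> (Mat2 s a 0 1) = Mat2 s (- (s * a) mod 3) 0 1"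
    if "s \<in> {1, 2}" "a \<in> {0, 1, 2}" for s a
    by (rule group.inv_equality) (use that in \<open>auto simp: carrier one mult\<close>)
  have flow: "is_flow (dihedral_group 3) example_graph (\<lambda>_. True) f"
    unfolding is_flow_def
  proof (intro conjI ballI)
    show "f \<in> arcs (graph example_graph) \<rightarrow> carrier (dihedral_group 3)"
      by (auto simp: example_graph_def f_def carrier)
  next
    fix v assume "v \<in> verts (graph example_graph)"
    then show "foldr (\<lambda>x y. x \<otimes>\<^bsub>dihedral_group 3\<^esub> y)
        (map (end_value (dihedral_group 3) (\<lambda>_. True) f) (rotation example_graph v))
        \<one>\<^bsub>dihedral_group 3\<^esub> = \<one>\<^bsub>dihedral_group 3\<^esub>"
      by (auto simp: example_graph_def f_def end_value_def inv one mult)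
  qed
  moreover have "nowhere_identity (dihedral_group 3) example_graph f"
    by (auto simp: nowhere_identity_def example_graph_def f_def one)
  ultimately show ?thesis
    unfolding admits_nowhere_identity_flow_def by blast
qed

lemma example_graph_not_admits_dihedral_3_flow:
  "\<not> admits_nowhere_identity_dihedral_flow 3 example_graph"
proof
  let ?D = infinite_dihedral_group
  assume "admits_nowhere_identity_dihedral_flow 3 example_graph"
  then obtain \<sigma> f where flow: "is_flow ?D example_graph \<sigma> f"
    and nonid: "nowhere_identity ?D example_graph f"
    and small: "f ` arcs (graph example_graph) \<subseteq> dihedral_below 3"
    unfolding admits_nowhere_identity_dihedral_flow_def by blast
  \<comment> \<open>The value is taken at the end at \<open>V\<close>, so that the three bridges can
    be multiplied there whatever their orientations.\<close>
  have bridge: "\<exists>a \<in> {2, - 2}. end_value ?D \<sigma> f (B i, True) = Mat2 1 a 0 1" if i: "i \<in> {1, 2, 3}" for i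
  proof -
    have arcs: "B i \<in> arcs (graph example_graph)" "L i \<in> arcs (graph example_graph)"
      "M i \<in> arcs (graph example_graph)" and vert: "U i \<in> verts (graph example_graph)"
      using i by (auto simp: example_graph_def)
    then have carrier: "f (B i) \<in> carrier ?D" "f (L i) \<in> carrier ?D" "f (M i) \<in> carrier ?D"
      using flow by (auto simp: is_flow_def)
    have "foldr (\<lambda>x y. x \<otimes>\<^bsub>?D\<^esub> y) (map (end_value ?D \<sigma> f) (rotation example_graph (U i))) \<one>\<^bsub>?D\<^esub> = \<one>\<^bsub>?D\<^esub>"
      using flow vert unfolding is_flow_def by blast
    moreover have "map (end_value ?D \<sigma> f) (rotation example_graph (U i)) =
        [end_value ?D \<sigma> f (B i, False), end_value ?D \<sigma> f (L i, False), end_value ?D \<sigma> f (M i, False),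
         inv\<^bsub>?D\<^esub> (end_value ?D \<sigma> f (L i, False)), inv\<^bsub>?D\<^esub> (end_value ?D \<sigma> f (M i, False))]"
      using carrier
      by (simp add: example_graph_def end_value_opposite[OF group_infinite_dihedral_group])
    ultimately obtain k where k: "end_value ?D \<sigma> f (B i, False) = Mat2 1 (2 * k) 0 1"
      using infinite_dihedral_commutator_even carrier
        end_value_closed[OF group_infinite_dihedral_group, of f]
      by (metis fst_conv)
    obtain s a where fB: "f (B i) = Mat2 s a 0 1" "s = 1 \<or> s = - 1"
      using carrier(1) unfolding carrier_infinite_dihedral_group by blast
    have "f (B i) \<in> dihedral_below 3" using small arcs(1) by blast
    then have "\<bar>a\<bar> < 3" by (auto simp: dihedral_below_def fB)
    moreover have "f (B i) \<noteq> Mat2 1 0 0 1"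
      using nonid arcs(1) by (auto simp: nowhere_identity_def)
    \<comment> \<open>Up to the sign given by the orientation, \<open>a\<close> is
      \<open>2 * k\<close>: the bound 3 leaves only -2, 0 and 2, and 0 would be the
      identity.\<close>
    ultimately have "k = 1 \<or> k = - 1"
      using k fB by (auto simp: end_value_def split: if_splits)
    then show ?thesis
      using k carrier by (auto simp: end_value_opposite[OF group_infinite_dihedral_group])
  qed
  from bridge[of 1] bridge[of 2] bridge[of 3] obtain a b c where
    "a \<in> {2, - 2}" "end_value ?D \<sigma> f (B 1, True) = Mat2 1 a 0 1"
    "b \<in> {2, - 2}" "end_value ?D \<sigma> f (B 2, True) = Mat2 1 b 0 1"
    "c \<in> {2, - 2}" "end_value ?D \<sigma> f (B 3, True) = Mat2 1 c 0 1"
    by auto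
  moreover have "foldr (\<lambda>x y. x \<otimes>\<^bsub>?D\<^esub> y) (map (end_value ?D \<sigma> f) (rotation example_graph V)) \<one>\<^bsub>?D\<^esub> = \<one>\<^bsub>?D\<^esub>"
    using flow by (simp add: is_flow_def example_graph_def)
  \<comment> \<open>The word at \<open>V\<close> is the translation by \<open>a + b + c\<close>,
    which is one of -6, -2, 2, 6.\<close>
  ultimately show False
    by (auto simp: example_graph_def)
qed

theorem mainTheorem1:
  shows "is_embedded_graph example_graph
    \<and> admits_nowhere_identity_flow (dihedral_group 3) example_graph
    \<and> \<not> admits_nowhere_identity_dihedral_flow 3 example_graph
    \<and> \<not> (\<forall>\<Gamma> :: (vertex, edge) embedded_graph. is_embedded_graph \<Gamma> \<longrightarrow>
          (admits_nowhere_identity_flow (dihedral_group 3) \<Gamma> \<longleftrightarrow>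
           admits_nowhere_identity_dihedral_flow 3 \<Gamma>))"
  \<comment> \<open>The example itself refutes the equivalence, in the direction from the finite
    group to the integers.\<close>
  using example_graph_embedded example_graph_admits_dihedral_group_3
    example_graph_not_admits_dihedral_3_flow by blast

end
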